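(* Let $(X,M,f,\alpha,\star)$ be a fuzzy $\mathscr{F}$-metric space and $A\subset X$. If $A$ is compact, then $A$ is $r$-totally bounded for all $r\in(0,1)$.
   Context: A continuous $t$-norm is a continuous map $\star:[0,1]\times[0,1]\to[0,1]$ that is associative, commutative, satisfies $a\star 1=a$ for all $a$, and $a\star c\le b\star d$ whenever $a\le b$ and $c\le d$. $\mathscr{F}$ is the set of functions $f:[0,1]\to[0,1]$ such that (1) $f$ is strictly increasing on $[0,1)$; (2) for every sequence $(t_n)$ in $[0,1]$, $\lim_n t_n=1$ if and only if $\lim_n f(t_n)=1$. A fuzzy $\mathscr{F}$-metric space $(X,M,f,\alpha,\star)$ consists of a nonempty set $X$, a continuous $t$-norm $\star$, a pair $(f,\alpha)\in\mathscr{F}\times(0,1]$ and a map $M:X\times X\times(0,\infty)\to[0,1]$ such that for all $x,y\in X$ and $t>0$: (i) $M(x,y,t)>0$; (ii) $M(x,y,s)=1$ for all $s>0$ if and only if $x=y$; (iii) $M(x,y,t)=M(y,x,t)$; (iv) for every integer $N\ge 2$, all $u_1,\dots,u_N\in X$ with $u_1=x$, $u_N=y$, and all $t_1,\dots,t_{N-1}>0$ with $t=t_1+\cdots+t_{N-1}$, if $M(x,y,t)<1$ then $(f(M(x,y,t)))^{\alpha}\ge f\big(M(u_1,u_2,t_1)\star\cdots\star M(u_{N-1},u_N,t_{N-1})\big)$. A sequence $(x_n)$ in $X$ is ($\mathscr{F}$-)convergent to $x\in X$ if $\lim_{n\to\infty}M(x_n,x,t)=1$ for all $t>0$. A subset $A\subset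 X$ is compact if every sequence in $A$ has a subsequence that converges to some point of $A$. For $r\in(0,1)$ and $\epsilon>0$, a subset $B\subset X$ is an $r$-$\epsilon$-net for $A\subset X$ if for every $x\in A$ there exists $y\in B$ with $M(x,y,\epsilon)>1-r$. $A$ is $r$-totally bounded if for every $\epsilon>0$ there exists a finite $r$-$\epsilon$-net for $A$. *)

theory Defs
  imports "HOL-Analysis.Analysis"
begin

text \<open>
  Functions on the unit interval are total functions on the reals of which only the values on
  \<open>{0..1}\<close> are constrained; likewise \<open>M x y t\<close> matters only for \<open>x\<close>, \<open>y\<close> in the carrier and \<open>t > 0\<close>.
\<close>

locale continuous_tnorm =
  fixes T :: "real \<Rightarrow> real \<Rightarrow> real"
  assumes maps: "\<lbrakk>a \<in> {0..1}; b \<in> {0..1}\<rbrakk> \<Longrightarrow> T a b \<in> {0..1}"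
    and cont: "continuous_on ({0..1} \<times> {0..1}) (\<lambda>(a, b). T a b)"
    and assoc: "\<lbrakk>a \<in> {0..1}; b \<in> {0..1}; c \<in> {0..1}\<rbrakk> \<Longrightarrow> T (T a b) c = T a (T b c)"
    and comm: "\<lbrakk>a \<in> {0..1}; b \<in> {0..1}\<rbrakk> \<Longrightarrow> T a b = T b a"
    and neutral: "a \<in> {0..1} \<Longrightarrow> T a 1 = a"
    and monotone: "\<lbrakk>a \<in> {0..1}; b \<in> {0..1}; c \<in> {0..1}; d \<in> {0..1}; a \<le> b; c \<le> d\<rbrakk>
      \<Longrightarrow> T a c \<le> T b d"

definition class_F :: "(real \<Rightarrow> real) set" where
  "class_F = {f. f ` {0..1} \<subseteq> {0..1} \<and> strict_mono_on {0..<1} f \<and>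
     (\<forall>s :: nat \<Rightarrow> real. (\<forall>n. s n \<in> {0..1}) \<longrightarrow>
        (s \<longlonglongrightarrow> 1 \<longleftrightarrow> (\<lambda>n. f (s n)) \<longlonglongrightarrow> 1))}"

text \<open>
  \<open>tnorm_prod T a n\<close> is the iterated product of \<open>a 1, \<dots>, a n\<close>; the empty product is the neutral
  element, so that for a t-norm the product of one factor is that factor.
\<close>

primrec tnorm_prod :: "(real \<Rightarrow> real \<Rightarrow> real) \<Rightarrow> (nat \<Rightarrow> real) \<Rightarrow> nat \<Rightarrow> real" where
  "tnorm_prod T a 0 = 1"
| "tnorm_prod T a (Suc n) = T (tnorm_prod T a n) (a (Suc n))"

locale fuzzy_F_metric_space = continuous_tnorm T
  for X :: "'a set" and M :: "'a \<Rightarrow> 'a \<Rightarrow> real \<Rightarrow> real" and f :: "real \<Rightarrow> real"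
    and \<alpha> :: real and T :: "real \<Rightarrow> real \<Rightarrow> real" +
  assumes nonempty: "X \<noteq> {}"
    and f_class: "f \<in> class_F"
    and alpha: "\<alpha> \<in> {0<..1}"
    and M_maps: "\<lbrakk>x \<in> X; y \<in> X; t > 0\<rbrakk> \<Longrightarrow> M x y t \<in> {0..1}"
    and M_pos: "\<lbrakk>x \<in> X; y \<in> X; t > 0\<rbrakk> \<Longrightarrow> M x y t > 0"
    and M_eq_1: "\<lbrakk>x \<in> X; y \<in> X\<rbrakk> \<Longrightarrow> (\<forall>s>0. M x y s = 1) \<longleftrightarrow> x = y"
    and M_sym: "\<lbrakk>x \<in> X; y \<in> X; t > 0\<rbrakk> \<Longrightarrow> M x y t = M y x t"
    and M_chain: "\<And>x y t N (u :: nat \<Rightarrow> 'a) (\<tau> :: nat \<Rightarrow> real).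
      \<lbrakk>x \<in> X; y \<in> X; t > 0; N \<ge> 2; \<forall>i\<in>{1..N}. u i \<in> X; u 1 = x; u N = y;
       \<forall>i\<in>{1..N-1}. \<tau> i > 0; t = (\<Sum>i=1..N-1. \<tau> i); M x y t < 1\<rbrakk>
      \<Longrightarrow> f (M x y t) powr \<alpha> \<ge> f (tnorm_prod T (\<lambda>i. M (u i) (u (Suc i)) (\<tau> i)) (N - 1))"

definition F_convergent :: "('a \<Rightarrow> 'a \<Rightarrow> real \<Rightarrow> real) \<Rightarrow> (nat \<Rightarrow> 'a) \<Rightarrow> 'a \<Rightarrow> bool" where
  "F_convergent M s x \<longleftrightarrow> (\<forall>t>0. (\<lambda>n. M (s n) x t) \<longlonglongrightarrow> 1)"

definition F_compact :: "('a \<Rightarrow> 'a \<Rightarrow> real \<Rightarrow> real) \<Rightarrow> 'a set \<Rightarrow> bool" where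
  "F_compact M A \<longleftrightarrow> (\<forall>s :: nat \<Rightarrow> 'a. (\<forall>n. s n \<in> A) \<longrightarrow>
     (\<exists>k :: nat \<Rightarrow> nat. strict_mono k \<and> (\<exists>x\<in>A. F_convergent M (s \<circ> k) x)))"

definition F_net ::
  "'a set \<Rightarrow> ('a \<Rightarrow> 'a \<Rightarrow> real \<Rightarrow> real) \<Rightarrow> real \<Rightarrow> real \<Rightarrow> 'a set \<Rightarrow> 'a set \<Rightarrow> bool" where
  "F_net X M r \<epsilon> B A \<longleftrightarrow> B \<subseteq> X \<and> (\<forall>x\<in>A. \<exists>y\<in>B. M x y \<epsilon> > 1 - r)"

definition F_totally_bounded ::
  "'a set \<Rightarrow> ('a \<Rightarrow> 'a \<Rightarrow> real \<Rightarrow> real) \<Rightarrow> real \<Rightarrow> 'a set \<Rightarrow> bool" where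
  "F_totally_bounded X M r A \<longleftrightarrow> (\<forall>\<epsilon>>0. \<exists>B. finite B \<and> F_net X M r \<epsilon> B A)"

end

theory Submission
  imports Defs
begin

text \<open>
  The proof follows the classical one for metric spaces. If \<open>A\<close> had no finite net at scale
  \<open>\<epsilon>\<close>, one could pick points of \<open>A\<close> one after another so that any two of them satisfy
  \<open>M x y \<epsilon> \<le> 1 - r\<close>. By compactness a subsequence converges to some \<open>x \<in> A\<close>, so that
  consecutive terms \<open>p\<close>, \<open>q\<close> of it have \<open>M p x (\<epsilon>/2)\<close> and \<open>M x q (\<epsilon>/2)\<close> tending to \<open>1\<close>. By
  continuity of the t-norm at \<open>(1, 1)\<close> their product tends to \<open>1\<close>, and by the defining property of
  \<open>class_F\<close> so does its image under \<open>f\<close>. But the chain inequality with the single intermediate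
  point \<open>x\<close> (lemma \<open>M_triangle\<close>) bounds this image by \<open>f (1 - r) powr \<alpha>\<close>, a constant
  that is strictly below \<open>1\<close> because a member of \<open>class_F\<close> reaches the value \<open>1\<close> at most at \<open>1\<close>.
\<close>

lemma class_F_less_1:
  assumes "f \<in> class_F" "0 \<le> a" "a < 1"
  shows "f a < 1"
proof -
  \<comment> \<open>Monotonicity is strict only below \<open>1\<close>, so compare with a second point of \<open>[0, 1)\<close>.\<close>
  have "f a < f ((a + 1) / 2)"
    using assms strict_mono_onD[of "{0..<1}" f a "(a + 1) / 2"] unfolding class_F_def by auto
  also have "f ((a + 1) / 2) \<le> 1"
  proof -
    have "(a + 1) / 2 \<in> {0..1}" using assms by auto
    then show ?thesis using assms(1) unfolding class_F_def by (auto simp: image_subset_iff)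
  qed
  finally show ?thesis .
qed

lemma class_F_mono_on:
  assumes "f \<in> class_F" "0 \<le> a" "a \<le> b" "b < 1"
  shows "f a \<le> f b"
  using assms strict_mono_on_leD[of "{0..<1}" f a b] unfolding class_F_def by auto

lemma class_F_nonneg:
  assumes "f \<in> class_F" "0 \<le> a" "a \<le> 1"
  shows "0 \<le> f a"
  using assms unfolding class_F_def by (auto simp: image_subset_iff)

lemma class_F_tendsto_1:
  assumes "f \<in> class_F" "\<And>n. s n \<in> {0..1}" "s \<longlonglongrightarrow> 1"
  shows "(\<lambda>n. f (s n)) \<longlonglongrightarrow> 1"
  using assms unfolding class_F_def by blast

lemma (in continuous_tnorm) tendsto_1:
  fixes a b :: "nat \<Rightarrow> real"
  assumes "\<And>n. a n \<in> {0..1}" "\<And>n. b n \<in> {0..1}" "a \<longlonglongrightarrow> 1" "b \<longlonglongrightarrow> 1"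
  shows "(\<lambda>n. T (a n) (b n)) \<longlonglongrightarrow> 1"
proof -
  have "(\<lambda>n. (a n, b n)) \<longlonglongrightarrow> (1, 1)"
    using assms by (intro tendsto_Pair)
  then have "(\<lambda>n. case (a n, b n) of (a, b) \<Rightarrow> T a b) \<longlonglongrightarrow> (case (1, 1) of (a, b) \<Rightarrow> T a b)"
    by (rule continuous_on_tendsto_compose[OF cont]) (use assms in auto)
  then show ?thesis using neutral[of 1] by simp
qed

lemma (in fuzzy_F_metric_space) M_triangle:
  assumes "x \<in> X" "y \<in> X" "z \<in> X" "s > 0" "t > 0" "M x z (s + t) < 1"
  shows "f (T (M x y s) (M y z t)) \<le> f (M x z (s + t)) powr \<alpha>"
proof -
  define u where "u i = (if i = 1 then x else if i = 2 then y else z)" for i :: nat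
  define \<tau> where "\<tau> i = (if i = 1 then s else t)" for i :: nat
  let ?p = "tnorm_prod T (\<lambda>i. M (u i) (u (Suc i)) (\<tau> i)) (3 - 1)"
  have "f ?p \<le> f (M x z (s + t)) powr \<alpha>"
    using assms by (intro M_chain) (auto simp: u_def \<tau>_def numeral_2_eq_2)
  moreover have "T 1 (M x y s) = M x y s"
    using comm[of 1] neutral M_maps[of x y s] assms by auto
  then have "?p = T (M x y s) (M y z t)"
    by (simp add: u_def \<tau>_def numeral_2_eq_2)
  ultimately show ?thesis by simp
qed

lemma separated_sequence_if_no_finite_net:
  assumes "A \<subseteq> X" "\<nexists>B. finite B \<and> F_net X M r \<epsilon> B A"
  shows "\<exists>s :: nat \<Rightarrow> 'a. \<forall>n. s n \<in> A \<and> (\<forall>m<n. M (s n) (s m) \<epsilon> \<le> 1 - r)"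
proof (rule dependent_wellorder_choice)
  fix n :: nat and s :: "nat \<Rightarrow> 'a"
  assume "\<And>m. m < n \<Longrightarrow> s m \<in> A \<and> (\<forall>l<m. M (s m) (s l) \<epsilon> \<le> 1 - r)"
  then have "s ` {..<n} \<subseteq> X" using assms(1) by auto
  \<comment> \<open>The finitely many points chosen so far do not form a net, so they miss some point of \<open>A\<close>.\<close>
  moreover have "\<not> F_net X M r \<epsilon> (s ` {..<n}) A" using assms(2) by blast
  ultimately show "\<exists>x. x \<in> A \<and> (\<forall>m<n. M x (s m) \<epsilon> \<le> 1 - r)"
    unfolding F_net_def by (auto simp: not_less)
qed simp

text \<open>
  Two consecutive terms of a convergent sequence would be joined through the limit by a chain
  whose product tends to \<open>1\<close>, which a uniform separation of the terms forbids.
\<close>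

lemma (in fuzzy_F_metric_space) convergent_not_separated:
  assumes s: "\<And>n. s n \<in> X" and x: "x \<in> X" and conv: "F_convergent M s x"
    and "\<epsilon> > 0" and c: "c < 1"
  shows "\<exists>n. M (s (Suc n)) (s n) \<epsilon> > c"
proof (rule ccontr)
  assume "\<nexists>n. M (s (Suc n)) (s n) \<epsilon> > c"
  then have sep: "M (s (Suc n)) (s n) \<epsilon> \<le> c" for n by (auto simp: not_less)
  define P where "P n = T (M (s (Suc n)) x (\<epsilon>/2)) (M x (s n) (\<epsilon>/2))" for n
  have half: "\<epsilon> / 2 > 0" using \<open>\<epsilon> > 0\<close> by simp
  have c0: "0 \<le> c"
    using M_pos[OF s s \<open>\<epsilon> > 0\<close>, of 1 0] sep[of 0] by simp
  have lim: "(\<lambda>n. M (s n) x (\<epsilon>/2)) \<longlonglongrightarrow> 1"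
    using conv half unfolding F_convergent_def by blast
  then have "P \<longlonglongrightarrow> 1"
    unfolding P_def using M_maps[OF s x half] M_maps[OF x s half] LIMSEQ_Suc[OF lim]
    by (intro tendsto_1) (simp_all add: M_sym[OF x s half])
  moreover have "P n \<in> {0..1}" for n
    unfolding P_def using M_maps[OF s x half] M_maps[OF x s half] by (intro maps)
  ultimately have "(\<lambda>n. f (P n)) \<longlonglongrightarrow> 1"
    using f_class class_F_tendsto_1 by blast
  moreover have "f (P n) \<le> f c powr \<alpha>" for n
  proof -
    have M01: "0 \<le> M (s (Suc n)) (s n) \<epsilon>" "M (s (Suc n)) (s n) \<epsilon> < 1"
      using M_maps[OF s s \<open>\<epsilon> > 0\<close>, of "Suc n" n] sep[of n] c by auto
    then have "f (P n) \<le> f (M (s (Suc n)) (s n) \<epsilon>) powr \<alpha>"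
      using M_triangle[OF s x s half half, of "Suc n" n] by (simp add: P_def)
    also have "\<dots> \<le> f c powr \<alpha>"
      using M01 c sep[of n] alpha class_F_mono_on[OF f_class M01(1) sep c]
        class_F_nonneg[OF f_class M01(1)]
      by (intro powr_mono2) auto
    finally show ?thesis .
  qed
  ultimately have "1 \<le> f c powr \<alpha>"
    by (intro LIMSEQ_le_const2) auto
  moreover have "f c powr \<alpha> < 1 powr \<alpha>"
    using class_F_less_1[OF f_class c0 c] class_F_nonneg[OF f_class c0] c alpha
    by (intro powr_less_mono2) auto
  ultimately show False by simp
qed

theorem theorem3p12:
  fixes X A :: "'a set" and M :: "'a \<Rightarrow> 'a \<Rightarrow> real \<Rightarrow> real" and f :: "real \<Rightarrow> real"
    and \<alpha> :: real and T :: "real \<Rightarrow> real \<Rightarrow> real"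
  assumes "fuzzy_F_metric_space X M f \<alpha> T"
    and "A \<subseteq> X"
    and "F_compact M A"
  shows "\<forall>r\<in>{0<..<1}. F_totally_bounded X M r A"
proof
  interpret fuzzy_F_metric_space X M f \<alpha> T by fact
  fix r :: real
  assume r: "r \<in> {0<..<1}"
  show "F_totally_bounded X M r A"
    unfolding F_totally_bounded_def
  proof (intro allI impI, rule ccontr)
    fix \<epsilon> :: real
    assume "\<epsilon> > 0" and "\<nexists>B. finite B \<and> F_net X M r \<epsilon> B A"
    then obtain s :: "nat \<Rightarrow> 'a"
      where s: "\<And>n. s n \<in> A" and sep: "\<And>n m. m < n \<Longrightarrow> M (s n) (s m) \<epsilon> \<le> 1 - r"
      using separated_sequence_if_no_finite_net[OF assms(2)] by metis
    obtain k x where "strict_mono k" "x \<in> A" "F_convergent M (s \<circ> k) x"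
      using assms(3) s unfolding F_compact_def by meson
    then obtain n where "M (s (k (Suc n))) (s (k n)) \<epsilon> > 1 - r"
      using convergent_not_separated[of "s \<circ> k" x \<epsilon> "1 - r"] s assms(2) \<open>\<epsilon> > 0\<close> r by auto
    moreover have "k n < k (Suc n)"
      using \<open>strict_mono k\<close> by (simp add: strict_mono_Suc_iff)
    ultimately show False using sep by (meson not_less)
  qed
qed

end
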